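(* Let $(X,d_X)$ and $(Y,d_Y)$ be unbounded proper metric spaces and let $T:\mathcal{SO}(X)\to\mathcal{SO}(Y)$ be a lattice isomorphism. Then there exist a uniquely determined homeomorphism $\tau:X\to Y$ induced by $T$ and a map $\mathfrak{t}:Y\times\mathbb{R}\to\mathbb{R}$ such that (1) $\mathfrak{t}(y,\cdot):\mathbb{R}\to\mathbb{R}$ is an increasing homeomorphism for each $y\in Y$, and (2) $T(f)(y)=\mathfrak{t}(y,f(\tau^{-1}(y)))$ for every $f\in\mathcal{SO}(X)$ and $y\in Y$. The same holds for a lattice isomorphism $T:\mathcal{SO}^{\ast}(X)\to\mathcal{SO}^{\ast}(Y)$ (with $\mathcal{SO}^{\ast}(X)$ in place of $\mathcal{SO}(X)$ in (2)).
   Context: A metric space $(X,d_X)$ is proper if every closed ball $B_{d_X}(x,r)=\{x'\in X: d_X(x,x')\le r\}$ is compact. A continuous function $f:X\to\mathbb{R}$ on a proper metric space is slowly oscillating if for every $R>0$ and $\varepsilon>0$ there is a compact $K\subset X$ such that $\operatorname{diam} f(B_{d_X}(x,R))<\varepsilon$ for every $x\in X\setminus K$. $\mathcal{SO}(X)$ is the set of all real-valued continuous slowly oscillating functions on $X$, and $\mathcal{SO}^{\ast}(X)$ is the subset of bounded ones; both are lattices under pointwise minimum $\wedge$ and maximum $\vee$. A lattice isomorphism is a bijection $T$ with $T(f\vee g)=T(f)\vee T(g)$ and $T(f\wedge g)=T(f)\wedge T(g)$ for all $f,g$ (no linearity is assumed). For $A(X)$ equal to $\mathcal{SO}(X)$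 or $\mathcal{SO}^{\ast}(X)$, a homeomorphism $\tau:X\to Y$ is said to be induced by a lattice isomorphism $T:A(X)\to A(Y)$ if for all $f,g\in A(X)$ and every open set $U\subset X$: $f\ge g$ on $U$ if and only if $T(f)\ge T(g)$ on $\tau(U)$. *)

theory Defs
  imports "HOL-Analysis.Analysis"
begin

text \<open>Metric spaces are types of class \<open>metric_space\<close>; the space itself is \<open>UNIV\<close>.\<close>

definition proper_space :: "'a::metric_space itself \<Rightarrow> bool" where
  "proper_space _ \<longleftrightarrow> (\<forall>(x::'a) r. compact (cball x r))"

text \<open>\<open>diameter\<close> has no meaningful value on unbounded sets; here continuity of \<open>f\<close> and
  compactness of closed balls in a proper space keep the images \<open>f ` cball x R\<close> bounded.\<close>

definition slowly_oscillating :: "('a::metric_space \<Rightarrow> real) \<Rightarrow> bool" where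
  "slowly_oscillating f \<longleftrightarrow>
     (\<forall>R>0. \<forall>\<epsilon>>0. \<exists>K. compact K \<and> (\<forall>x. x \<notin> K \<longrightarrow> diameter (f ` cball x R) < \<epsilon>))"

definition SO :: "('a::metric_space \<Rightarrow> real) set" where
  "SO = {f. continuous_on UNIV f \<and> slowly_oscillating f}"

definition SO_bdd :: "('a::metric_space \<Rightarrow> real) set" where
  "SO_bdd = {f \<in> SO. bounded (range f)}"

text \<open>On real-valued functions \<open>sup\<close> and \<open>inf\<close> are the pointwise maximum and minimum. The map \<open>T\<close>
  is a total function of which only the values on \<open>A\<close> matter.\<close>

definition lattice_isomorphism ::
    "('a \<Rightarrow> real) set \<Rightarrow> ('b \<Rightarrow> real) set \<Rightarrow> (('a \<Rightarrow> real) \<Rightarrow> ('b \<Rightarrow> real)) \<Rightarrow> bool" where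
  "lattice_isomorphism A B T \<longleftrightarrow>
     bij_betw T A B \<and>
     (\<forall>f\<in>A. \<forall>g\<in>A. T (sup f g) = sup (T f) (T g) \<and> T (inf f g) = inf (T f) (T g))"

definition induced_homeomorphism ::
    "('a::metric_space \<Rightarrow> real) set \<Rightarrow> (('a \<Rightarrow> real) \<Rightarrow> ('b::metric_space \<Rightarrow> real)) \<Rightarrow> ('a \<Rightarrow> 'b) \<Rightarrow> bool" where
  "induced_homeomorphism A T \<tau> \<longleftrightarrow>
     homeomorphism UNIV UNIV \<tau> (inv \<tau>) \<and>
     (\<forall>f\<in>A. \<forall>g\<in>A. \<forall>U. open U \<longrightarrow>
        ((\<forall>x\<in>U. f x \<ge> g x) \<longleftrightarrow> (\<forall>y\<in>\<tau> ` U. T f y \<ge> T g y)))"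

end

theory Submission
  imports Defs
begin

text \<open>A lattice isomorphism \<open>T\<close> between two of these function lattices preserves the order and, for
  functions above a common base \<open>g\<close>, the relation \<open>inf f b = g\<close>, which says that the sets where
  \<open>f\<close> and \<open>b\<close> exceed \<open>g\<close> are disjoint. Because the lattices contain enough bumps, disjointness makes
  \<open>T\<close> local: an inequality on the open set where \<open>b\<close> exceeds \<open>g\<close> is carried over to the open set where
  \<open>T b\<close> exceeds \<open>T g\<close> (\<open>le_on_carrier\<close>).

  Call \<open>x\<close> and \<open>y\<close> linked over \<open>g\<close> if every \<open>f \<ge> g\<close> that equals \<open>g\<close> near \<open>x\<close> has \<open>T f y = T g y\<close>.
  Locality makes this relation symmetric under passing to the inverse of \<open>T\<close>, inherited by larger
  bases, and one-to-one (\<open>linked_inverse\<close>, \<open>linked_mono\<close>, \<open>linked_unique_left\<close>). Every \<open>x\<close> has a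
  partner (\<open>linked_exists\<close>): if it had none in any ball, which is compact, then shrinking
  neighbourhoods of \<open>x\<close> would correspond to sets running off to infinity. Slowly oscillating
  functions, however, can alternate between two given ones along a sequence tending to infinity
  (\<open>SO_alternate_at_infinity\<close>), and no continuous function can do so at \<open>x\<close> when the two differ there.
  Comparing bases through their infimum shows that the partner of \<open>x\<close> is the same for all of them.
  The resulting bijection is continuous in both directions, and \<open>T f\<close> at the partner of \<open>x\<close> depends
  only on the germ of \<open>f\<close> at \<open>x\<close>.

  That it depends only on the value \<open>f x\<close> uses the metric: two functions that agree at \<open>x\<close>
  can be interpolated by a third one that equals each of them near infinitely many points tending to
  \<open>x\<close> (\<open>pointwise_eq\<close>). Hence \<open>T f y\<close> is the value of \<open>T\<close> at a constant function, which gives the maps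
  \<open>\<tt> y\<close>; they are strictly increasing and surjective since \<open>T\<close> is an isomorphism, and such functions of
  a real variable are homeomorphisms.

  The bounded and the unbounded case differ only in the verification of the properties collected in
  the locale \<open>separating_lattice\<close>.\<close>

section \<open>A Lipschitz function with gaps along a divergent sequence\<close>

text \<open>\<open>\<Psi>\<close> is four times the distance to a closed set that contains \<open>{..1}\<close> and intervals around every
  second member of a fast growing subsequence of \<open>c\<close>, so the remaining members lie at a distance
  proportional to their size. Composed with a slowly oscillating function that tends to infinity it
  gives slowly oscillating functions that switch between two behaviours arbitrarily far out; composed
  with the reciprocal distance to a point it gives functions that switch arbitrarily close to
  the point.\<close>

lemma oscillating_gauge:
  fixes c :: "nat \<Rightarrow> real"
  assumes "filterlim c at_top sequentially"
  obtains s :: "nat \<Rightarrow> nat" and \<Psi> :: "real \<Rightarrow> real" where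
    "strict_mono s" "\<And>t. 0 \<le> \<Psi> t" "\<And>t u. \<bar>\<Psi> t - \<Psi> u\<bar> \<le> 4 * \<bar>t - u\<bar>"
    "\<And>t. t \<le> 1 \<Longrightarrow> \<Psi> t = 0"
    "\<And>n. max 1 (c (s (2 * n))) < \<Psi> (c (s (2 * n)))"
    "\<And>n t. \<bar>t - c (s (2 * n + 1))\<bar> < 1 \<Longrightarrow> \<Psi> t = 0"
proof -
  have large: "\<exists>m>n. c m \<ge> K" for n K
  proof -
    have "eventually (\<lambda>m. c m \<ge> K \<and> m > n) sequentially"
      using assms eventually_gt_at_top[of n] by (auto simp: filterlim_at_top eventually_conj_iff)
    then show ?thesis
      using eventually_happens'[OF sequentially_bot] by blast
  qed
  have "\<exists>s. \<forall>n::nat. c (s n) \<ge> 5 \<and> (s (Suc n) > s n \<and> c (s (Suc n)) \<ge> 3 * c (s n) + 5)"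
  proof (rule dependent_nat_choice)
    show "\<exists>x. 5 \<le> c x"
      using large by blast
    show "\<exists>y. 5 \<le> c y \<and> y > x \<and> c y \<ge> 3 * c x + 5" if "5 \<le> c x" for x and n :: nat
    proof -
      obtain y where "y > x" "c y \<ge> 3 * c x + 5"
        using large by blast
      moreover have "5 \<le> 3 * c x + 5"
        using that by simp
      ultimately show ?thesis
        by (meson order_trans)
    qed
  qed
  then obtain s where s5: "\<And>n. c (s n) \<ge> 5" and s_less: "\<And>n. s n < s (Suc n)"
    and s_step: "\<And>n. c (s (Suc n)) \<ge> 3 * c (s n) + 5"
    by blast
  have mono: "c (s m) \<le> c (s n)" if "m \<le> n" for m n
    using that
  proof (induction rule: dec_induct)
    case (step k)
    then show ?case
      using s_step[of k] s5[of k] by linarith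
  qed simp
  define C where "C = {t. t \<le> 1 \<or> (\<exists>n. \<bar>t - c (s (2 * n + 1))\<bar> \<le> 1)}"
  define \<Psi> where "\<Psi> t = 4 * infdist t C" for t
  have C1: "1 \<in> C"
    by (simp add: C_def)
  show ?thesis
  proof
    show "strict_mono s"
      using s_less by (simp add: strict_mono_Suc_iff)
    show "0 \<le> \<Psi> t" for t
      by (simp add: \<Psi>_def infdist_nonneg)
    show "\<bar>\<Psi> t - \<Psi> u\<bar> \<le> 4 * \<bar>t - u\<bar>" for t u
      using infdist_triangle[of t C u] infdist_triangle[of u C t]
      unfolding \<Psi>_def dist_real_def by (smt (verit))
    show "\<Psi> t = 0" if "t \<le> 1" for t
      using that by (simp add: \<Psi>_def C_def)
    show "\<Psi> t = 0" if "\<bar>t - c (s (2 * n + 1))\<bar> < 1" for n t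
      using that by (auto simp: \<Psi>_def C_def intro!: infdist_zero less_imp_le)
    show "max 1 (c (s (2 * n))) < \<Psi> (c (s (2 * n)))" for n
    proof -
      let ?a = "c (s (2 * n))"
      have "2 * ?a / 3 \<le> dist ?a t" if "t \<in> C" for t
        using that unfolding C_def
      proof (safe)
        assume "t \<le> 1"
        then show ?thesis
          using s5[of "2 * n"] by (auto simp: dist_real_def)
      next
        fix m
        assume m: "\<bar>t - c (s (2 * m + 1))\<bar> \<le> 1"
        show ?thesis
        proof (cases "m < n")
          case True
          then have "c (s (2 * m + 1)) \<le> c (s (2 * n - 1))" and "Suc (2 * n - 1) = 2 * n"
            by (auto intro!: mono)
          then show ?thesis
            using s_step[of "2 * n - 1"] m s5[of "2 * n"] by (auto simp: dist_real_def)
        next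
          case False
          then have "c (s (Suc (2 * n))) \<le> c (s (2 * m + 1))"
            by (auto intro!: mono)
          then show ?thesis
            using s_step[of "2 * n"] m s5[of "2 * n"] by (auto simp: dist_real_def)
        qed
      qed
      then have "2 * ?a / 3 \<le> infdist ?a C"
        using C1 cINF_greatest[of C "2 * ?a / 3" "dist ?a"] by (fastforce simp: infdist_def)
      then show ?thesis
        using s5[of "2 * n"] by (simp add: \<Psi>_def)
    qed
  qed
qed

section \<open>The function lattices\<close>

text \<open>The properties of \<open>SO\<close> and \<open>SO_bdd\<close> on which the argument rests. \<open>modify\<close> says that membership
  depends only on the behaviour near infinity, so that points can be separated locally; the last
  property separates points near infinity: between \<open>p\<close> and \<open>q\<close> there is a function that equals
  \<open>q\<close> and \<open>p\<close> alternately near the points of a subsequence of any sequence tending to infinity.\<close>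

locale separating_lattice =
  fixes A :: "('a::metric_space \<Rightarrow> real) set"
  assumes proper: "compact (cball (x::'a) r)"
    and cont: "f \<in> A \<Longrightarrow> continuous_on UNIV f"
    and const: "(\<lambda>_. c) \<in> A"
    and plus: "f \<in> A \<Longrightarrow> g \<in> A \<Longrightarrow> (\<lambda>x. f x + g x) \<in> A"
    and sup: "f \<in> A \<Longrightarrow> g \<in> A \<Longrightarrow> sup f g \<in> A"
    and inf: "f \<in> A \<Longrightarrow> g \<in> A \<Longrightarrow> inf f g \<in> A"
    and modify: "f \<in> A \<Longrightarrow> continuous_on UNIV k \<Longrightarrow> compact K \<Longrightarrow> (\<And>x. x \<notin> K \<Longrightarrow> k x = f x) \<Longrightarrow> k \<in> A"
    and alternate_at_infinity:
      "p \<in> A \<Longrightarrow> q \<in> A \<Longrightarrow> p \<le> q \<Longrightarrow> filterlim (\<lambda>n. dist x (y n)) at_top sequentially \<Longrightarrow>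
        \<exists>k\<in>A. \<exists>s::nat \<Rightarrow> nat. strict_mono s \<and> p \<le> k \<and> k \<le> q \<and>
          (\<forall>n. \<forall>\<^sub>F z in nhds (y (s (2 * n))). k z = q z) \<and>
          (\<forall>n. \<forall>\<^sub>F z in nhds (y (s (2 * n + 1))). k z = p z)"

lemma eventually_nhds_continuous_less:
  fixes f g :: "'a::topological_space \<Rightarrow> real"
  assumes "continuous_on UNIV f" "continuous_on UNIV g" "f x < g x"
  shows "\<forall>\<^sub>F z in nhds x. f z < g z"
  using open_Collect_less[OF assms(1,2)] assms(3) by (auto simp: eventually_nhds)

lemma proper_spaceD: "proper_space TYPE('a::metric_space) \<Longrightarrow> compact (cball (x::'a) r)"
  by (simp add: proper_space_def)

text \<open>In a proper space a set is contained in a compact set iff it is bounded, so the exceptional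
  compact set can be taken to be a ball around a fixed centre \<open>a\<close>.\<close>

lemma SO_iff:
  fixes f :: "'a::metric_space \<Rightarrow> real" and a :: 'a
  assumes proper: "proper_space TYPE('a)"
  shows "f \<in> SO \<longleftrightarrow> continuous_on UNIV f \<and>
    (\<forall>R>0. \<forall>\<epsilon>>0. \<exists>\<rho>. \<forall>x z. \<rho> < dist a x \<longrightarrow> dist x z \<le> R \<longrightarrow> \<bar>f x - f z\<bar> < \<epsilon>)"
    (is "_ \<longleftrightarrow> _ \<and> ?osc")
proof (cases "continuous_on UNIV f")
  case True
  have "slowly_oscillating f \<longleftrightarrow> ?osc"
  proof
    assume f: "slowly_oscillating f"
    show ?osc
    proof (intro allI impI)
      fix R \<epsilon> :: real
      assume "R > 0" "\<epsilon> > 0"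
      then obtain K where "compact K" and K: "\<And>x. x \<notin> K \<Longrightarrow> diameter (f ` cball x R) < \<epsilon>"
        using f unfolding slowly_oscillating_def by meson
      obtain \<rho> where \<rho>: "\<And>x. x \<in> K \<Longrightarrow> dist a x \<le> \<rho>"
        using compact_imp_bounded[OF \<open>compact K\<close>] bounded_any_center[of K a] by auto
      have "\<bar>f x - f z\<bar> < \<epsilon>" if "\<rho> < dist a x" "dist x z \<le> R" for x z
      proof -
        have "bounded (f ` cball x R)"
          using True proper_spaceD[OF proper]
          by (intro compact_imp_bounded compact_continuous_image) (auto intro: continuous_on_subset)
        then have "dist (f x) (f z) \<le> diameter (f ` cball x R)"
          using that \<open>R > 0\<close> by (intro diameter_bounded_bound) auto
        also have "\<dots> < \<epsilon>"
          using K[of x] \<rho>[of x] that by force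
        finally show ?thesis
          by (simp add: dist_real_def)
      qed
      then show "\<exists>\<rho>. \<forall>x z. \<rho> < dist a x \<longrightarrow> dist x z \<le> R \<longrightarrow> \<bar>f x - f z\<bar> < \<epsilon>"
        by blast
    qed
  next
    assume osc: ?osc
    show "slowly_oscillating f"
      unfolding slowly_oscillating_def
    proof (intro allI impI)
      fix R \<epsilon> :: real
      assume "R > 0" "\<epsilon> > 0"
      then obtain \<rho> where \<rho>: "\<And>x z. \<rho> < dist a x \<Longrightarrow> dist x z \<le> R \<Longrightarrow> \<bar>f x - f z\<bar> < \<epsilon> / 4"
        using osc[rule_format, of R "\<epsilon> / 4"] by auto
      have "diameter (f ` cball x R) < \<epsilon>" if "x \<notin> cball a \<rho>" for x
      proof -
        have "norm (u - v) \<le> \<epsilon> / 2" if uv: "u \<in> f ` cball x R" "v \<in> f ` cball x R" for u v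
        proof -
          obtain z w where "dist x z \<le> R" "u = f z" "dist x w \<le> R" "v = f w"
            using uv by auto
          then show ?thesis
            using \<rho>[of x z] \<rho>[of x w] \<open>x \<notin> cball a \<rho>\<close> by (auto simp: abs_if split: if_splits)
        qed
        then have "diameter (f ` cball x R) \<le> \<epsilon> / 2"
          using \<open>\<epsilon> > 0\<close> by (intro diameter_le) auto
        then show ?thesis
          using \<open>\<epsilon> > 0\<close> by simp
      qed
      then show "\<exists>K. compact K \<and> (\<forall>x. x \<notin> K \<longrightarrow> diameter (f ` cball x R) < \<epsilon>)"
        using proper_spaceD[OF proper] by blast
    qed
  qed
  then show ?thesis
    using True by (simp add: SO_def)
qed (simp add: SO_def)

text \<open>A single estimate that covers sums, differences, lattice operations and composition with the
  function \<open>\<Psi>\<close> of \<open>oscillating_gauge\<close>; the factor 4 is the Lipschitz constant of the latter.\<close>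

lemma SO_lipschitz_combination:
  fixes f g h :: "'a::metric_space \<Rightarrow> real"
  assumes proper: "proper_space TYPE('a)" and f: "f \<in> SO" and g: "g \<in> SO"
    and h: "continuous_on UNIV h" "\<And>x z. \<bar>h x - h z\<bar> \<le> 4 * \<bar>f x - f z\<bar> + 4 * \<bar>g x - g z\<bar>"
  shows "h \<in> SO"
proof -
  fix a :: 'a
  note iff = SO_iff[OF proper, where a = a]
  show ?thesis
    unfolding iff
  proof (intro conjI h(1) allI impI)
    fix R \<epsilon> :: real
    assume "R > 0" "\<epsilon> > 0"
    obtain \<rho> where \<rho>: "\<And>x z. \<rho> < dist a x \<Longrightarrow> dist x z \<le> R \<Longrightarrow> \<bar>f x - f z\<bar> < \<epsilon> / 8"
      using f \<open>R > 0\<close> \<open>\<epsilon> > 0\<close> unfolding iff by (metis zero_less_divide_iff zero_less_numeral)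
    obtain \<sigma> where \<sigma>: "\<And>x z. \<sigma> < dist a x \<Longrightarrow> dist x z \<le> R \<Longrightarrow> \<bar>g x - g z\<bar> < \<epsilon> / 8"
      using g \<open>R > 0\<close> \<open>\<epsilon> > 0\<close> unfolding iff by (metis zero_less_divide_iff zero_less_numeral)
    have "\<bar>h x - h z\<bar> < \<epsilon>" if "max \<rho> \<sigma> < dist a x" "dist x z \<le> R" for x z
      using h(2)[of x z] \<rho>[of x z] \<sigma>[of x z] that by auto
    then show "\<exists>\<rho>. \<forall>x z. \<rho> < dist a x \<longrightarrow> dist x z \<le> R \<longrightarrow> \<bar>h x - h z\<bar> < \<epsilon>"
      by blast
  qed
qed

lemma SO_const: "proper_space TYPE('a) \<Longrightarrow> (\<lambda>_::'a::metric_space. c) \<in> SO"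
  by (subst SO_iff[where a = undefined]) auto

lemma SO_plus:
  fixes f g :: "'a::metric_space \<Rightarrow> real"
  assumes "proper_space TYPE('a)" "f \<in> SO" "g \<in> SO"
  shows "(\<lambda>x. f x + g x) \<in> SO"
  using assms by (intro SO_lipschitz_combination[OF assms]) (auto simp: SO_def intro!: continuous_intros, (smt (verit))+)

lemma SO_diff:
  fixes f g :: "'a::metric_space \<Rightarrow> real"
  assumes "proper_space TYPE('a)" "f \<in> SO" "g \<in> SO"
  shows "(\<lambda>x. f x - g x) \<in> SO"
  using assms by (intro SO_lipschitz_combination[OF assms]) (auto simp: SO_def intro!: continuous_intros, (smt (verit))+)

lemma SO_sup:
  fixes f g :: "'a::metric_space \<Rightarrow> real"
  assumes "proper_space TYPE('a)" "f \<in> SO" "g \<in> SO"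
  shows "sup f g \<in> SO"
  using assms by (intro SO_lipschitz_combination[OF assms])
    (auto simp: SO_def sup_fun_def sup_max intro!: continuous_intros, (smt (verit))+)

lemma SO_inf:
  fixes f g :: "'a::metric_space \<Rightarrow> real"
  assumes "proper_space TYPE('a)" "f \<in> SO" "g \<in> SO"
  shows "inf f g \<in> SO"
  using assms by (intro SO_lipschitz_combination[OF assms])
    (auto simp: SO_def inf_fun_def inf_min intro!: continuous_intros, (smt (verit))+)

lemma SO_lipschitz_comp:
  fixes f :: "'a::metric_space \<Rightarrow> real" and \<Psi> :: "real \<Rightarrow> real"
  assumes "proper_space TYPE('a)" "f \<in> SO" "\<And>t u. \<bar>\<Psi> t - \<Psi> u\<bar> \<le> 4 * \<bar>t - u\<bar>"
  shows "(\<lambda>x. \<Psi> (f x)) \<in> SO"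
proof (rule SO_lipschitz_combination[OF assms(1,2) SO_const[OF assms(1), of 0]])
  have "4-lipschitz_on UNIV \<Psi>"
    using assms(3) by (auto simp: lipschitz_on_def dist_real_def)
  then show "continuous_on UNIV (\<lambda>x. \<Psi> (f x))"
    using assms(2) by (auto simp: SO_def intro: continuous_on_compose2 lipschitz_on_continuous_on)
qed (use assms(3) in auto)

lemma SO_modify:
  fixes f k :: "'a::metric_space \<Rightarrow> real"
  assumes proper: "proper_space TYPE('a)" and f: "f \<in> SO" and k: "continuous_on UNIV k"
    and K: "compact K" "\<And>x. x \<notin> K \<Longrightarrow> k x = f x"
  shows "k \<in> SO"
proof -
  fix a :: 'a
  note iff = SO_iff[OF proper, where a = a]
  obtain \<sigma> where \<sigma>: "\<And>x. x \<in> K \<Longrightarrow> dist a x \<le> \<sigma>"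
    using compact_imp_bounded[OF \<open>compact K\<close>] bounded_any_center[of K a] by auto
  show ?thesis
    unfolding iff
  proof (intro conjI k allI impI)
    fix R \<epsilon> :: real
    assume "R > 0" "\<epsilon> > 0"
    obtain \<rho> where \<rho>: "\<And>x z. \<rho> < dist a x \<Longrightarrow> dist x z \<le> R \<Longrightarrow> \<bar>f x - f z\<bar> < \<epsilon>"
      using f \<open>R > 0\<close> \<open>\<epsilon> > 0\<close> unfolding iff by metis
    have "\<bar>k x - k z\<bar> < \<epsilon>" if "max \<rho> (\<sigma> + R) < dist a x" "dist x z \<le> R" for x z
    proof -
      have "\<sigma> < dist a x" "\<sigma> < dist a z"
        using that dist_triangle[of a x z] \<open>R > 0\<close> by (auto simp: dist_commute)
      then have "k x = f x" "k z = f z"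
        using K(2) \<sigma> by (meson not_le)+
      then show ?thesis
        using \<rho>[of x z] that by auto
    qed
    then show "\<exists>\<rho>. \<forall>x z. \<rho> < dist a x \<longrightarrow> dist x z \<le> R \<longrightarrow> \<bar>k x - k z\<bar> < \<epsilon>"
      by blast
  qed
qed

lemma ln_add_one_diff_le:
  fixes s t :: real
  assumes "0 \<le> s" "s \<le> t"
  shows "ln (1 + t) - ln (1 + s) \<le> (t - s) / (1 + s)"
proof -
  have "ln (1 + t) - ln (1 + s) = ln ((1 + t) / (1 + s))"
    using assms by (simp add: ln_div)
  also have "\<dots> \<le> (1 + t) / (1 + s) - 1"
    using assms by (intro ln_le_minus_one) auto
  also have "\<dots> = (t - s) / (1 + s)"
    using assms by (simp add: field_simps)
  finally show ?thesis .
qed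

text \<open>A slowly oscillating function that tends to infinity.\<close>

lemma SO_log_dist:
  fixes a :: "'a::metric_space"
  assumes proper: "proper_space TYPE('a)"
  shows "(\<lambda>x. ln (1 + dist a x)) \<in> SO"
  unfolding SO_iff[OF proper, where a = a]
proof (intro conjI allI impI)
  show "continuous_on UNIV (\<lambda>x. ln (1 + dist a x))"
    by (intro continuous_intros) (metis add_increasing2 add_le_same_cancel1 not_one_le_zero zero_le_dist add.commute)
  fix R \<epsilon> :: real
  assume "R > 0" "\<epsilon> > 0"
  have "\<bar>ln (1 + dist a x) - ln (1 + dist a z)\<bar> < \<epsilon>" if x: "R / \<epsilon> + R < dist a x" and "dist x z \<le> R" for x z
  proof -
    have log_mono: "ln (1 + u) \<le> ln (1 + v)" if "0 \<le> u" "u \<le> v" for u v :: real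
      using that by simp
    define s where "s = min (dist a x) (dist a z)"
    define t where "t = max (dist a x) (dist a z)"
    have "t - s \<le> R" "dist a x - R \<le> s"
      using \<open>dist x z \<le> R\<close> dist_triangle[of a x z] dist_triangle[of a z x] \<open>R > 0\<close>
      by (auto simp: s_def t_def dist_commute)
    then have s: "R / \<epsilon> < s"
      using x by linarith
    then have "0 < s"
      using \<open>R > 0\<close> \<open>\<epsilon> > 0\<close> by (meson divide_pos_pos order_less_trans)
    have "\<bar>ln (1 + dist a x) - ln (1 + dist a z)\<bar> = ln (1 + t) - ln (1 + s)"
      using log_mono[of "dist a x" "dist a z"] log_mono[of "dist a z" "dist a x"]
      by (cases "dist a x \<le> dist a z") (simp_all add: s_def t_def min_def max_def)
    also have "\<dots> \<le> (t - s) / (1 + s)"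
      using \<open>0 < s\<close> by (intro ln_add_one_diff_le) (auto simp: s_def t_def)
    also have "\<dots> \<le> R / (1 + s)"
      using \<open>t - s \<le> R\<close> \<open>0 < s\<close> by (intro divide_right_mono) auto
    also have "\<dots> < \<epsilon>"
      using s \<open>0 < s\<close> \<open>\<epsilon> > 0\<close> by (simp add: field_simps)
    finally show ?thesis .
  qed
  then show "\<exists>\<rho>. \<forall>x z. \<rho> < dist a x \<longrightarrow> dist x z \<le> R \<longrightarrow> \<bar>ln (1 + dist a x) - ln (1 + dist a z)\<bar> < \<epsilon>"
    by blast
qed

text \<open>Composing a Lipschitz function with a slowly oscillating \<open>v\<close> keeps slow oscillation no matter
  how \<open>v\<close> grows, whereas multiplication by cut-off functions
  in general does not. Hence \<open>v\<close> is chosen to dominate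
  \<open>q - p\<close> and to tend to infinity along \<open>y\<close>, and the oscillation happens in the values of \<open>v\<close>.\<close>

lemma SO_alternate_at_infinity:
  fixes p q :: "'a::metric_space \<Rightarrow> real"
  assumes proper: "proper_space TYPE('a)" and p: "p \<in> SO" and q: "q \<in> SO" and "p \<le> q"
    and y: "filterlim (\<lambda>n. dist a (y n)) at_top sequentially"
  shows "\<exists>k\<in>SO. \<exists>s::nat \<Rightarrow> nat. strict_mono s \<and> p \<le> k \<and> k \<le> q \<and>
          (\<forall>n. \<forall>\<^sub>F z in nhds (y (s (2 * n))). k z = q z) \<and>
          (\<forall>n. \<forall>\<^sub>F z in nhds (y (s (2 * n + 1))). k z = p z)"
proof -
  define v where "v x = q x - p x + ln (1 + dist a x)" for x
  have v: "v \<in> SO"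
    unfolding v_def[abs_def] by (intro SO_plus SO_diff SO_log_dist proper p q)
  have qp: "q x - p x \<le> v x" for x
    by (simp add: v_def)
  have "filterlim (\<lambda>n. ln (1 + dist a (y n))) at_top sequentially"
    by (rule filterlim_compose[OF ln_at_top filterlim_tendsto_add_at_top[OF tendsto_const y]])
  then have "filterlim (\<lambda>n. v (y n)) at_top sequentially"
    by (rule filterlim_at_top_mono) (use \<open>p \<le> q\<close> in \<open>auto simp: v_def le_fun_def\<close>)
  then obtain s :: "nat \<Rightarrow> nat" and \<Psi> :: "real \<Rightarrow> real" where s: "strict_mono s"
    and \<Psi>: "\<And>t. 0 \<le> \<Psi> t" "\<And>t u. \<bar>\<Psi> t - \<Psi> u\<bar> \<le> 4 * \<bar>t - u\<bar>" "\<And>t. t \<le> 1 \<Longrightarrow> \<Psi> t = 0"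
    and even: "\<And>n. max 1 (v (y (s (2 * n)))) < \<Psi> (v (y (s (2 * n))))"
    and odd: "\<And>n t. \<bar>t - v (y (s (2 * n + 1)))\<bar> < 1 \<Longrightarrow> \<Psi> t = 0"
    by (rule oscillating_gauge[where c = "\<lambda>n. v (y n)"]) (rule that, assumption+)
  define w where "w = (\<lambda>x. \<Psi> (v x))"
  have w: "w \<in> SO"
    unfolding w_def by (rule SO_lipschitz_comp[OF proper v \<Psi>(2)])
  \<comment> \<open>The minimum makes \<open>k\<close> equal to \<open>q\<close> where \<open>w > v\<close>, and bounded when \<open>p\<close> and \<open>q\<close> are.\<close>
  define k where "k x = p x + min (w x) (q x - p x)" for x
  have "(\<lambda>x. q x - p x) \<in> SO"
    by (intro SO_diff proper p q)
  from SO_inf[OF proper w this] have "(\<lambda>x. min (w x) (q x - p x)) \<in> SO"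
    by (simp add: inf_fun_def inf_min)
  then have "k \<in> SO"
    unfolding k_def[abs_def] by (intro SO_plus proper p)
  moreover have "p \<le> k" "k \<le> q"
    using \<open>p \<le> q\<close> \<Psi>(1) by (auto simp: k_def w_def le_fun_def)
  moreover have "\<forall>\<^sub>F z in nhds (y (s (2 * n))). k z = q z" for n
  proof -
    have "\<forall>\<^sub>F z in nhds (y (s (2 * n))). v z < w z"
      using v w even[of n] by (intro eventually_nhds_continuous_less) (auto simp: SO_def w_def)
    then show ?thesis
      by eventually_elim (use qp in \<open>smt (verit) k_def\<close>)
  qed
  moreover have "\<forall>\<^sub>F z in nhds (y (s (2 * n + 1))). k z = p z" for n
  proof -
    have "\<forall>\<^sub>F z in nhds (y (s (2 * n + 1))). \<bar>v z - v (y (s (2 * n + 1)))\<bar> < 1"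
      using v by (intro eventually_nhds_continuous_less) (auto simp: SO_def intro!: continuous_intros)
    then show ?thesis
      by eventually_elim (use \<open>p \<le> q\<close> odd in \<open>auto simp: k_def w_def le_fun_def\<close>)
  qed
  ultimately show ?thesis
    using s by blast
qed

lemma separating_lattice_SO:
  assumes "proper_space TYPE('a::metric_space)"
  shows "separating_lattice (SO :: ('a \<Rightarrow> real) set)"
proof
  show "f \<in> SO \<Longrightarrow> continuous_on UNIV f" for f :: "'a \<Rightarrow> real"
    by (simp add: SO_def)
qed (use assms in \<open>auto simp del: One_nat_def intro: proper_spaceD SO_const SO_plus SO_sup SO_inf SO_modify SO_alternate_at_infinity\<close>)

lemma SO_bdd_iff: "f \<in> SO_bdd \<longleftrightarrow> f \<in> SO \<and> (\<exists>M. \<forall>x. \<bar>f x\<bar> \<le> M)"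
  by (auto simp: SO_bdd_def bounded_iff)

lemma SO_bdd_between:
  assumes "f \<in> SO_bdd" "g \<in> SO_bdd" "h \<in> SO" "\<And>x. min (f x) (g x) \<le> h x" "\<And>x. h x \<le> max (f x) (g x)"
  shows "h \<in> SO_bdd"
proof -
  obtain M N where M: "\<And>x. \<bar>f x\<bar> \<le> M" and N: "\<And>x. \<bar>g x\<bar> \<le> N"
    using assms(1,2) by (auto simp: SO_bdd_iff)
  have "\<bar>h x\<bar> \<le> max M N" for x
    using assms(4,5)[of x] M[of x] N[of x] by (auto simp: min_def max_def abs_le_iff split: if_splits)
  then show ?thesis
    using assms(3) by (auto simp: SO_bdd_iff)
qed

lemma separating_lattice_SO_bdd:
  assumes "proper_space TYPE('a::metric_space)"
  shows "separating_lattice (SO_bdd :: ('a \<Rightarrow> real) set)"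
proof -
  interpret SO: separating_lattice "SO :: ('a \<Rightarrow> real) set"
    by (rule separating_lattice_SO[OF assms])
  have bddD: "f \<in> SO" if "f \<in> SO_bdd" for f :: "'a \<Rightarrow> real"
    using that by (simp add: SO_bdd_iff)
  show ?thesis
  proof
    fix f g :: "'a \<Rightarrow> real"
    assume f: "f \<in> SO_bdd"
    show "continuous_on UNIV f"
      using f by (auto intro: SO.cont bddD)
    show "k \<in> SO_bdd" if k: "continuous_on UNIV k" "compact K" "\<And>x. x \<notin> K \<Longrightarrow> k x = f x" for k K
    proof -
      obtain M where M: "\<And>x. \<bar>f x\<bar> \<le> M"
        using f by (auto simp: SO_bdd_iff)
      have "bounded (k ` K)"
        using k(1,2) by (intro compact_imp_bounded compact_continuous_image) (auto intro: continuous_on_subset)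
      then obtain N where N: "\<And>x. x \<in> K \<Longrightarrow> \<bar>k x\<bar> \<le> N"
        by (auto simp: bounded_iff)
      have "\<bar>k x\<bar> \<le> max M N" for x
        using M[of x] N[of x] k(3)[of x] by (cases "x \<in> K") auto
      then show ?thesis
        using SO.modify[OF bddD[OF f] k] by (auto simp: SO_bdd_iff)
    qed
    assume g: "g \<in> SO_bdd"
    show "sup f g \<in> SO_bdd"
      using SO_bdd_between[OF f g SO.sup] f g by (auto simp: sup_max bddD)
    show "inf f g \<in> SO_bdd"
      using SO_bdd_between[OF f g SO.inf] f g by (auto simp: inf_min bddD)
    obtain M N where "\<And>x. \<bar>f x\<bar> \<le> M" "\<And>x. \<bar>g x\<bar> \<le> N"
      using f g by (auto simp: SO_bdd_iff)
    then have "\<bar>f x + g x\<bar> \<le> M + N" for x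
      by (meson abs_triangle_ineq add_mono order_trans)
    then show "(\<lambda>x. f x + g x) \<in> SO_bdd"
      using SO.plus f g by (auto simp: SO_bdd_iff)
  next
    fix p q :: "'a \<Rightarrow> real" and a :: 'a and y :: "nat \<Rightarrow> 'a"
    assume pq: "p \<in> SO_bdd" "q \<in> SO_bdd" "p \<le> q" and y: "filterlim (\<lambda>n. dist a (y n)) at_top sequentially"
    have bdd: "k \<in> SO_bdd" if "k \<in> SO" "p \<le> k" "k \<le> q" for k
      using that by (intro SO_bdd_between[OF pq(1,2)]) (auto simp: le_fun_def min_le_iff_disj le_max_iff_disj)
    show "\<exists>k\<in>SO_bdd. \<exists>s::nat \<Rightarrow> nat. strict_mono s \<and> p \<le> k \<and> k \<le> q \<and>
          (\<forall>n. \<forall>\<^sub>F z in nhds (y (s (2 * n))). k z = q z) \<and>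
          (\<forall>n. \<forall>\<^sub>F z in nhds (y (s (2 * n + 1))). k z = p z)"
      using SO.alternate_at_infinity[OF bddD bddD pq(3) y, OF pq(1,2)] bdd by meson
  qed (use SO.proper SO.const in \<open>auto simp: SO_bdd_iff\<close>)
qed

context separating_lattice
begin

text \<open>The local counterpart of \<open>alternate_at_infinity\<close>: \<open>k\<close> passes from \<open>f\<close> to \<open>g\<close> inside a prescribed
  neighbourhood of \<open>x\<close>.\<close>

lemma bump:
  assumes f: "f \<in> A" and g: "g \<in> A" and fg: "f \<le> g" and P: "\<forall>\<^sub>F z in nhds x. P z"
  shows "\<exists>k\<in>A. f \<le> k \<and> k \<le> g \<and> (\<forall>\<^sub>F z in nhds x. k z = g z) \<and> k x = g x \<and>
    (\<forall>z. \<not> P z \<longrightarrow> (\<forall>\<^sub>F w in nhds z. k w = f w) \<and> k z = f z)"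
proof -
  obtain W where W: "open W" "x \<in> W" "\<And>z. z \<in> W \<Longrightarrow> P z"
    using P by (auto simp: eventually_nhds)
  obtain e where e: "e > 0" "cball x e \<subseteq> W"
    using W open_contains_cball by blast
  define \<phi> where "\<phi> z = max 0 (min 1 (2 - 2 * dist x z / e))" for z
  define k where "k z = f z + \<phi> z * (g z - f z)" for z
  have \<phi>01: "0 \<le> \<phi> z" "\<phi> z \<le> 1" for z
    by (auto simp: \<phi>_def)
  have f_le: "f z \<le> g z" for z
    using fg by (simp add: le_fun_def)
  have k1: "k z = g z" if "dist x z < e / 2" for z
    using that e(1) by (auto simp: k_def \<phi>_def min_def max_def field_simps)
  have k0: "k z = f z" if "e \<le> dist x z" for z
    using that e(1) by (auto simp: k_def \<phi>_def min_def max_def field_simps)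
  show ?thesis
  proof (intro bexI[of _ k] conjI allI impI)
    show "f \<le> k"
      using \<phi>01 f_le by (simp add: le_fun_def k_def)
    have "k z \<le> g z" for z
      using mult_right_mono[OF \<phi>01(2)[of z], of "g z - f z"] f_le[of z] by (simp add: k_def)
    then show "k \<le> g"
      by (simp add: le_fun_def)
    show "\<forall>\<^sub>F z in nhds x. k z = g z"
      using eventually_nhds_in_open[of "ball x (e / 2)" x] e(1)
      by (auto elim!: eventually_mono simp: k1)
    then show "k x = g x"
      by (rule eventually_nhds_x_imp_x)
    show "\<forall>\<^sub>F w in nhds z. k w = f w" if "\<not> P z" for z
    proof -
      have "z \<in> - cball x e"
        using W(3) e(2) that by blast
      then have "\<forall>\<^sub>F w in nhds z. w \<in> - cball x e"
        by (intro eventually_nhds_in_open) auto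
      then show ?thesis
        by eventually_elim (simp add: k0)
    qed
    then show "k z = f z" if "\<not> P z" for z
      using that eventually_nhds_x_imp_x by blast
    have "continuous_on UNIV k"
      unfolding k_def[abs_def] \<phi>_def using e(1) by (intro continuous_intros cont f g) auto
    then show "k \<in> A"
      using modify[OF f _ proper[of x e]] k0 by force
  qed
qed

lemma add_one: "f \<in> A \<Longrightarrow> (\<lambda>x. f x + 1) \<in> A"
  using plus const by blast

lemma unit_bump:
  assumes f: "f \<in> A" and W: "\<forall>\<^sub>F z in nhds x. P z"
  shows "\<exists>k\<in>A. f \<le> k \<and> k x = f x + 1 \<and> (\<forall>z. \<not> P z \<longrightarrow> k z = f z)"
proof -
  have "f \<le> (\<lambda>x. f x + 1)"
    by (simp add: le_fun_def)
  from bump[OF f add_one[OF f] this W] show ?thesis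
    by auto
qed

end

section \<open>Local comparison under a lattice isomorphism\<close>

text \<open>\<open>linked A T g x y\<close>: seen from the base function \<open>g\<close>, the germ at \<open>x\<close> determines the value of the
  image at \<open>y\<close>. The base is kept as a parameter because disjointness, the only locality that a
  lattice expresses directly, is disjointness of the sets where functions exceed a common lower
  bound.\<close>

definition linked ::
    "('a::metric_space \<Rightarrow> real) set \<Rightarrow> (('a \<Rightarrow> real) \<Rightarrow> ('b \<Rightarrow> real)) \<Rightarrow> ('a \<Rightarrow> real) \<Rightarrow> 'a \<Rightarrow> 'b \<Rightarrow> bool" where
  "linked A T g x y \<longleftrightarrow>
     (\<forall>f\<in>A. g \<le> f \<longrightarrow> (\<forall>\<^sub>F z in nhds x. f z = g z) \<longrightarrow> T f y = T g y)"

lemma linkedD: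
  "linked A T g x y \<Longrightarrow> f \<in> A \<Longrightarrow> g \<le> f \<Longrightarrow> \<forall>\<^sub>F z in nhds x. f z = g z \<Longrightarrow> T f y = T g y"
  by (simp add: linked_def)

locale lattice_iso = X: separating_lattice A + Y: separating_lattice B
  for A :: "('a::metric_space \<Rightarrow> real) set" and B :: "('b::metric_space \<Rightarrow> real) set" +
  fixes T :: "('a \<Rightarrow> real) \<Rightarrow> ('b \<Rightarrow> real)"
  assumes iso: "lattice_isomorphism A B T"
begin

abbreviation S where "S \<equiv> inv_into A T"

lemma bij: "bij_betw T A B"
  using iso by (simp add: lattice_isomorphism_def)

lemma T_in [simp]: "f \<in> A \<Longrightarrow> T f \<in> B"
  using bij by (auto simp: bij_betw_def)

lemma S_in [simp]: "h \<in> B \<Longrightarrow> S h \<in> A"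
  using bij by (auto simp: bij_betw_def intro: inv_into_into)

lemma ST [simp]: "f \<in> A \<Longrightarrow> S (T f) = f"
  using bij by (auto simp: bij_betw_def)

lemma TS [simp]: "h \<in> B \<Longrightarrow> T (S h) = h"
  using bij by (auto simp: bij_betw_def f_inv_into_f)

lemma T_sup: "f \<in> A \<Longrightarrow> g \<in> A \<Longrightarrow> T (sup f g) = sup (T f) (T g)"
  using iso by (simp add: lattice_isomorphism_def)

lemma T_inf: "f \<in> A \<Longrightarrow> g \<in> A \<Longrightarrow> T (inf f g) = inf (T f) (T g)"
  using iso by (simp add: lattice_isomorphism_def)

text \<open>Every statement about \<open>T\<close> can thus be used for \<open>S\<close> as well, with the two spaces exchanged.\<close>

lemma inverse: "lattice_iso B A S"
proof
  have "S (sup h k) = sup (S h) (S k)" "S (inf h k) = inf (S h) (S k)" if "h \<in> B" "k \<in> B" for h k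
  proof -
    have "sup h k = T (sup (S h) (S k))" "inf h k = T (inf (S h) (S k))"
      using that by (simp_all add: T_sup T_inf)
    then show "S (sup h k) = sup (S h) (S k)" "S (inf h k) = inf (S h) (S k)"
      using that by (simp_all add: X.sup X.inf)
  qed
  then show "lattice_isomorphism B A S"
    using bij_betw_inv_into[OF bij] by (simp add: lattice_isomorphism_def)
qed

lemma inverse_of_S: "f \<in> A \<Longrightarrow> inv_into B S f = T f"
proof -
  interpret inv: lattice_iso B A S
    by (rule inverse)
  show "f \<in> A \<Longrightarrow> inv_into B S f = T f"
    using inv.ST[of "T f"] by simp
qed

lemma T_le_iff: "f \<in> A \<Longrightarrow> g \<in> A \<Longrightarrow> T f \<le> T g \<longleftrightarrow> f \<le> g"
  by (metis ST T_sup X.sup sup.absorb_iff2)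

lemma T_le: "f \<in> A \<Longrightarrow> g \<in> A \<Longrightarrow> f \<le> g \<Longrightarrow> T f \<le> T g"
  by (simp add: T_le_iff)

lemma T_le_at: "f \<in> A \<Longrightarrow> g \<in> A \<Longrightarrow> f \<le> g \<Longrightarrow> T f y \<le> T g y"
  using T_le by (simp add: le_fun_def)

text \<open>If \<open>f\<close> returns to \<open>g\<close> wherever \<open>b\<close> exceeds \<open>g\<close>, then \<open>inf f b = g\<close>, an equation that \<open>T\<close> preserves.\<close>

lemma disjoint_carriers:
  assumes "f \<in> A" "g \<in> A" "b \<in> A" "g \<le> f" "g \<le> b" and "\<And>z. b z > g z \<Longrightarrow> f z = g z"
    and "T b y > T g y"
  shows "T f y = T g y"
proof -
  have "inf f b = g"
  proof
    fix z
    show "inf f b z = g z"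
      using assms(4,5) assms(6)[of z]
      by (cases "b z > g z") (auto simp: le_fun_def inf_min min_def not_less antisym)
  qed
  then have "inf (T f) (T b) = T g"
    using assms(1,3) by (metis T_inf)
  then have "min (T f y) (T b y) = T g y"
    by (metis inf_fun_def inf_min)
  then show ?thesis
    using assms(7) by (auto simp: min_def split: if_splits)
qed

text \<open>An inequality that holds where \<open>b\<close> exceeds \<open>g\<close> is carried over to the set where \<open>T b\<close> exceeds
  \<open>T g\<close>. To see it at \<open>y\<close>, cut \<open>T F\<close> down to a function \<open>p\<close> that still agrees with it at \<open>y\<close> but equals
  \<open>T g\<close> where \<open>T b\<close> does. By disjointness \<open>S p\<close> equals \<open>g\<close> off the closure of the set where \<open>b\<close>
  exceeds \<open>g\<close>, and on this closure it is below \<open>F\<close>, which is below \<open>q\<close> there. Hence \<open>S p \<le> q\<close>,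
  and \<open>p \<le> T q\<close> is evaluated at \<open>y\<close>.\<close>

lemma le_on_carrier:
  assumes A: "g \<in> A" "F \<in> A" "q \<in> A" "b \<in> A" and "g \<le> F" "g \<le> q" "g \<le> b"
    and W: "\<And>z. b z > g z \<Longrightarrow> F z \<le> q z"
    and y: "T b y > T g y"
  shows "T F y \<le> T q y"
proof -
  interpret inv: lattice_iso B A S
    by (rule inverse)
  have "\<forall>\<^sub>F z in nhds y. T g z < T b z"
    using A y by (intro eventually_nhds_continuous_less Y.cont) auto
  from Y.bump[OF T_in[OF A(1)] T_in[OF A(2)] T_le[OF A(1,2) \<open>g \<le> F\<close>] this]
  obtain p where p: "p \<in> B" "T g \<le> p" "p \<le> T F" "p y = T F y"
      and p_off: "\<And>z. \<not> T g z < T b z \<Longrightarrow> p z = T g z"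
    by blast
  have gp: "g \<le> S p" and pF: "S p \<le> F"
    using inv.T_le[OF _ p(1,2)] inv.T_le[OF p(1) _ p(3)] A by auto
  have "S p z \<le> q z" for z
  proof (cases "z \<in> closure {w. b w > g w}")
    case True
    have "closed {w. F w \<le> q w}"
      using A by (intro closed_Collect_le X.cont)
    then have "closure {w. b w > g w} \<subseteq> {w. F w \<le> q w}"
      using W by (intro closure_minimal) auto
    then show ?thesis
      using True pF by (auto simp: le_fun_def intro: order_trans)
  next
    case False
    then have "\<forall>\<^sub>F w in nhds z. w \<notin> closure {w. b w > g w}"
      using eventually_nhds_in_open[of "- closure {w. b w > g w}" z] by auto
    then obtain c where c: "c \<in> A" "g \<le> c" "c z = g z + 1"
      and c_off: "\<And>w. w \<in> closure {w. b w > g w} \<Longrightarrow> c w = g w"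
      using X.unit_bump[OF A(1)] by blast
    have Tc: "T c w = T g w" if "T b w > T g w" for w
    proof (rule disjoint_carriers[OF c(1) A(1,4) c(2) \<open>g \<le> b\<close> _ that])
      show "c v = g v" if "g v < b v" for v
        using that closure_subset[of "{w. b w > g w}"] by (intro c_off) auto
    qed
    have "S p z = S (T g) z"
    proof (rule inv.disjoint_carriers[OF p(1) T_in[OF A(1)] T_in[OF c(1)] p(2) T_le[OF A(1) c(1,2)]])
      show "p w = T g w" if "T g w < T c w" for w
        using that Tc[of w] by (intro p_off) auto
      show "S (T g) z < S (T c) z"
        using A(1) c by simp
    qed
    then show ?thesis
      using A \<open>g \<le> q\<close> by (simp add: le_fun_def)
  qed
  then have "S p \<le> q"
    by (simp add: le_fun_def)
  then have "p \<le> T q"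
    using T_le[of "S p" q] A p(1) by simp
  then show ?thesis
    using p(4) by (metis le_funD)
qed

text \<open>Being linked is symmetric. If \<open>q = T g\<close> near \<open>y\<close> but \<open>S q\<close> exceeded \<open>g\<close> at \<open>x\<close>, then for a bump \<open>c\<close>
  over \<open>T g\<close> at \<open>y\<close> disjoint from \<open>q\<close>, the function \<open>S c\<close> would be \<open>g\<close> near \<open>x\<close>, and the link
  would force \<open>c y = T g y\<close>.\<close>

lemma linked_inverse:
  assumes "linked A T g x y" and g: "g \<in> A"
  shows "linked B S (T g) y x"
  unfolding linked_def
proof (intro ballI impI)
  fix q
  assume q: "q \<in> B" "T g \<le> q" and near: "\<forall>\<^sub>F z in nhds y. q z = T g z"
  interpret inv: lattice_iso B A S
    by (rule inverse)
  have gq: "g \<le> S q"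
    using inv.T_le[of "T g" q] q g by simp
  show "S q x = S (T g) x"
  proof (rule ccontr)
    assume "S q x \<noteq> S (T g) x"
    then have "g x < S q x"
      using g gq by (auto simp: le_fun_def less_le)
    then have "\<forall>\<^sub>F z in nhds x. g z < S q z"
      using g q by (intro eventually_nhds_continuous_less X.cont) auto
    moreover obtain c where c: "c \<in> B" "T g \<le> c" "c y = T g y + 1"
      and c_off: "\<And>z. \<not> q z = T g z \<Longrightarrow> c z = T g z"
      using Y.unit_bump[OF T_in[OF g] near] by blast
    have "S c z = S (T g) z" if "g z < S q z" for z
    proof (rule inv.disjoint_carriers[OF c(1) T_in[OF g] q(1) c(2) q(2)])
      show "c w = T g w" if "T g w < q w" for w
        using that by (intro c_off) simp
      show "S (T g) z < S q z"
        using that g by simp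
    qed
    ultimately have "\<forall>\<^sub>F z in nhds x. S c z = g z"
      using g by (simp add: eventually_mono)
    moreover have "g \<le> S c"
      using inv.T_le[OF T_in[OF g] c(1,2)] g by simp
    ultimately have "T (S c) y = T g y"
      using linkedD[OF assms(1) S_in[OF c(1)]] by blast
    then show False
      using c by simp
  qed
qed

text \<open>A link compares not only functions with the base, but any two functions above it. For a bump
  \<open>b\<close> at \<open>x\<close> supported where \<open>F \<le> q\<close>, the inequality \<open>T F \<le> T q\<close> holds where \<open>T b\<close> exceeds \<open>T g\<close>, and
  \<open>y\<close> is in the closure of this set: otherwise \<open>T b = T g\<close> near \<open>y\<close>, and the inverse link
  would force \<open>b x = g x\<close>.\<close>

lemma linked_le:
  assumes "linked A T g x y" and A: "g \<in> A" "F \<in> A" "q \<in> A" "g \<le> F" "g \<le> q"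
    and near: "\<forall>\<^sub>F z in nhds x. F z \<le> q z"
  shows "T F y \<le> T q y"
proof -
  interpret inv: lattice_iso B A S
    by (rule inverse)
  obtain b where b: "b \<in> A" "g \<le> b" "b x = g x + 1" and b_off: "\<And>z. \<not> F z \<le> q z \<Longrightarrow> b z = g z"
    using X.unit_bump[OF A(1) near] by blast
  have le: "T F w \<le> T q w" if "T b w > T g w" for w
  proof (rule le_on_carrier[OF A(1-3) b(1) A(4,5) b(2) _ that])
    show "F z \<le> q z" if "g z < b z" for z
      using that b_off[of z] by force
  qed
  have "y \<in> closure {w. T b w > T g w}"
  proof (rule ccontr)
    assume "y \<notin> closure {w. T b w > T g w}"
    then have "\<forall>\<^sub>F w in nhds y. w \<in> - closure {w. T b w > T g w}"
      by (intro eventually_nhds_in_open) auto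
    then have "\<forall>\<^sub>F w in nhds y. T b w = T g w"
    proof eventually_elim
      case (elim w)
      then have "\<not> T b w > T g w"
        using closure_subset[of "{w. T b w > T g w}"] by auto
      then show ?case
        using T_le_at[of g b w] A b by simp
    qed
    then have "S (T b) x = S (T g) x"
      by (rule linkedD[OF linked_inverse[OF assms(1) A(1)] T_in[OF b(1)] T_le[OF A(1) b(1,2)]])
    then show False
      using A b by simp
  qed
  moreover have "closure {w. T b w > T g w} \<subseteq> {w. T F w \<le> T q w}"
    using le A by (intro closure_minimal closed_Collect_le Y.cont) auto
  ultimately show ?thesis
    by blast
qed

lemma linked_mono:
  assumes "linked A T g x y" "g \<in> A" "g' \<in> A" "g \<le> g'"
  shows "linked A T g' x y"
  unfolding linked_def
proof (intro ballI impI antisym)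
  fix f
  assume "f \<in> A" "g' \<le> f" and near: "\<forall>\<^sub>F z in nhds x. f z = g' z"
  moreover have "\<forall>\<^sub>F z in nhds x. f z \<le> g' z" "\<forall>\<^sub>F z in nhds x. g' z \<le> f z"
    using near by (auto elim: eventually_mono)
  ultimately show "T f y \<le> T g' y" "T g' y \<le> T f y"
    using assms by (auto intro!: linked_le[OF assms(1)])
qed

lemma linked_unique_left:
  assumes "linked A T g x y" "linked A T g x' y" and g: "g \<in> A"
  shows "x = x'"
proof (rule ccontr)
  assume "x \<noteq> x'"
  define F where "F = S (\<lambda>z. T g z + 1)"
  have F: "F \<in> A" "T F = (\<lambda>z. T g z + 1)"
    using Y.add_one[of "T g"] g by (auto simp: F_def)
  have "g \<le> F"
    using T_le_iff[of g F] F g by (auto simp: le_fun_def)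
  have "\<forall>\<^sub>F z in nhds x'. z \<noteq> x"
    using \<open>x \<noteq> x'\<close> eventually_nhds_in_open[of "- {x}" x'] by auto
  from X.bump[OF g F(1) \<open>g \<le> F\<close> this]
  obtain k where k: "k \<in> A" "g \<le> k" "\<forall>\<^sub>F z in nhds x'. k z = F z" "\<forall>\<^sub>F z in nhds x. k z = g z"
    by blast
  have "T k y = T g y"
    using assms(1) k unfolding linked_def by blast
  moreover have "T F y \<le> T k y"
    using k \<open>g \<le> F\<close> F g by (intro linked_le[OF assms(2)]) (auto elim: eventually_mono)
  ultimately show False
    by (simp add: F)
qed

lemma linked_unique_right:
  assumes "linked A T g x y" "linked A T g x y'" and g: "g \<in> A"
  shows "y = y'"
proof -
  interpret inv: lattice_iso B A S
    by (rule inverse)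
  show ?thesis
    by (rule inv.linked_unique_left[OF linked_inverse[OF assms(1) g] linked_inverse[OF assms(2) g] T_in[OF g]])
qed

section \<open>Existence of linked points\<close>

lemma finite_sup_bound:
  assumes "finite \<F>" and "\<And>f. f \<in> \<F> \<Longrightarrow> f \<in> A \<and> g \<le> f \<and> (\<forall>\<^sub>F z in nhds x. f z = g z)" and g: "g \<in> A"
  shows "\<exists>h\<in>A. g \<le> h \<and> (\<forall>\<^sub>F z in nhds x. h z = g z) \<and> (\<forall>f\<in>\<F>. f \<le> h)"
  using assms(1,2)
proof (induction \<F>)
  case empty
  then show ?case
    using g by auto
next
  case (insert f \<F>)
  then obtain h where h: "h \<in> A" "g \<le> h" "\<forall>\<^sub>F z in nhds x. h z = g z" "\<forall>f\<in>\<F>. f \<le> h"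
    by blast
  have f: "f \<in> A" "\<forall>\<^sub>F z in nhds x. f z = g z"
    using insert.prems by auto
  have "\<forall>\<^sub>F z in nhds x. sup f h z = g z"
    using f(2) h(3) by eventually_elim auto
  show ?case
  proof (intro bexI[of _ "sup f h"] conjI ballI)
    show "g \<le> sup f h"
      using h(2) by (rule le_supI2)
    show "f' \<le> sup f h" if "f' \<in> insert f \<F>" for f'
      using that h(4) by (auto intro: le_supI2 simp del: sup_apply)
    show "sup f h \<in> A"
      using f(1) h(1) by (rule X.sup)
  qed fact
qed

text \<open>A point \<open>x\<close> without partner gives at every \<open>y\<close> a function witnessing this; by compactness one
  function serves all \<open>y\<close> in \<open>K\<close>.\<close>

lemma lift_off_compact:
  assumes unlinked: "\<And>y. \<not> linked A T g x y" and g: "g \<in> A" and K: "compact K"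
  obtains f where "f \<in> A" "g \<le> f" "\<forall>\<^sub>F z in nhds x. f z = g z" "\<And>y. y \<in> K \<Longrightarrow> T g y < T f y"
proof -
  define \<F> where "\<F> = {f\<in>A. g \<le> f \<and> (\<forall>\<^sub>F z in nhds x. f z = g z)}"
  have opens: "open {y. T g y < T f y}" if "f \<in> \<F>" for f
    using that g by (intro open_Collect_less Y.cont) (auto simp: \<F>_def)
  have cover: "K \<subseteq> (\<Union>f\<in>\<F>. {y. T g y < T f y})"
  proof
    fix y
    obtain f where "f \<in> \<F>" "T f y \<noteq> T g y"
      using unlinked[of y] by (auto simp: linked_def \<F>_def)
    moreover from this have "T g y \<le> T f y"
      using g by (intro T_le_at) (auto simp: \<F>_def)
    ultimately show "y \<in> (\<Union>f\<in>\<F>. {y. T g y < T f y})"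
      by force
  qed
  obtain \<G> where \<G>: "\<G> \<subseteq> \<F>" "finite \<G>" "K \<subseteq> (\<Union>f\<in>\<G>. {y. T g y < T f y})"
    by (rule compactE_image[OF K opens cover])
  obtain h where h: "h \<in> A" "g \<le> h" "\<forall>\<^sub>F z in nhds x. h z = g z" "\<forall>f\<in>\<G>. f \<le> h"
    using finite_sup_bound[OF \<G>(2), of g x] \<G>(1) g by (auto simp: \<F>_def)
  show ?thesis
  proof (rule that[OF h(1-3)])
    fix y
    assume "y \<in> K"
    then obtain f where "f \<in> \<G>" "T g y < T f y"
      using \<G>(3) by blast
    moreover from this have "T f y \<le> T h y"
      using h \<G>(1) by (intro T_le_at) (auto simp: \<F>_def)
    ultimately show "T g y < T h y"
      by simp
  qed
qed

text \<open>The only way for \<open>x\<close> to have no partner would be that the partner escapes to infinity. Suppose it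
  does. Then bumps \<open>b n\<close> over \<open>g\<close>, shrinking to \<open>x\<close>, have images that exceed \<open>T g\<close> at points \<open>y n\<close>
  tending to infinity. Take \<open>k\<close> that equals \<open>T (g + 1)\<close> and \<open>T g\<close> alternately near a subsequence
  of \<open>y\<close>. Pulled back to \<open>X\<close>, it is at least \<open>g + 1\<close> at points arbitrarily close to \<open>x\<close>, and at most \<open>g\<close>
  at others, which contradicts continuity at \<open>x\<close>.\<close>

lemma linked_exists:
  assumes g: "g \<in> A"
  shows "\<exists>y. linked A T g x y"
proof (rule ccontr)
  assume "\<nexists>y. linked A T g x y"
  then have unlinked: "\<And>y. \<not> linked A T g x y"
    by blast
  interpret inv: lattice_iso B A S
    by (rule inverse)
  fix a :: 'b
  have "\<exists>y b. real n < dist a y \<and> b \<in> A \<and> g \<le> b \<and> (\<forall>z. inverse (Suc n) \<le> dist x z \<longrightarrow> b z = g z) \<and>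
      T g y < T b y" for n
  proof -
    obtain f where f: "f \<in> A" "g \<le> f" "\<forall>\<^sub>F z in nhds x. f z = g z"
        "\<And>y. y \<in> cball a n \<Longrightarrow> T g y < T f y"
      using lift_off_compact[OF unlinked g Y.proper[of a n]] by metis
    have "\<forall>\<^sub>F z in nhds x. z \<in> ball x (inverse (Suc n))"
      by (intro eventually_nhds_in_open) auto
    then have "\<forall>\<^sub>F z in nhds x. f z = g z \<and> dist x z < inverse (Suc n)"
      using f(3) by (simp add: eventually_conj_iff)
    then obtain b where b: "b \<in> A" "g \<le> b" "b x = g x + 1"
        and b_off: "\<And>z. \<not> (f z = g z \<and> dist x z < inverse (Suc n)) \<Longrightarrow> b z = g z"
      using X.unit_bump[OF g] by blast
    have "\<not> T b \<le> T g"
      using b g T_le_iff[of b g] by (auto simp: le_fun_def dest: spec[of _ x])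
    then obtain y where y: "T g y < T b y"
      by (auto simp: le_fun_def not_le)
    have "T f y = T g y"
    proof (rule disjoint_carriers[OF f(1) g b(1) f(2) b(2) _ y])
      show "f z = g z" if "g z < b z" for z
        using that b_off[of z] by force
    qed
    then have "real n < dist a y"
      using f(4)[of y] by (auto simp: not_less[symmetric])
    then show ?thesis
      using b(1,2) b_off y by (meson not_le)
  qed
  then obtain y b where y: "\<And>n. real n < dist a (y n)" and b: "\<And>n. b n \<in> A" "\<And>n. g \<le> b n"
      and b_off: "\<And>n z. inverse (Suc n) \<le> dist x z \<Longrightarrow> b n z = g z" and Tb: "\<And>n. T g (y n) < T (b n) (y n)"
    by metis
  define F where "F z = g z + 1" for z
  have F: "F \<in> A" "g \<le> F"
    unfolding F_def[abs_def] using g X.add_one by (auto simp: le_fun_def)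
  have "filterlim (\<lambda>n. dist a (y n)) at_top sequentially"
    by (rule filterlim_at_top_mono[OF filterlim_real_sequentially]) (intro always_eventually allI less_imp_le y)
  from Y.alternate_at_infinity[OF T_in[OF g] T_in[OF F(1)] T_le[OF g F] this]
  obtain k and s :: "nat \<Rightarrow> nat" where k: "k \<in> B" "T g \<le> k" and s: "strict_mono s"
    and even: "\<And>n. \<forall>\<^sub>F z in nhds (y (s (2 * n))). k z = T F z"
    and odd: "\<And>n. \<forall>\<^sub>F z in nhds (y (s (2 * n + 1))). k z = T g z"
    by blast
  have gSk: "g \<le> S k"
    using inv.T_le[of "T g" k] k g by simp
  \<comment> \<open>Whatever holds near \<open>y n\<close> holds where some \<open>c\<close> below \<open>T (b n)\<close> exceeds \<open>T g\<close>; its pull-back \<open>S c\<close> is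
    below \<open>b n\<close> and hence exceeds \<open>g\<close> only near \<open>x\<close>.\<close>
  have near: "\<exists>w. dist x w < inverse (Suc n) \<and> R w"
    if P: "\<forall>\<^sub>F z in nhds (y n). P z"
      and R: "\<And>c w. c \<in> B \<Longrightarrow> T g \<le> c \<Longrightarrow> (\<And>z. c z > T g z \<Longrightarrow> P z) \<Longrightarrow> S c w > g w \<Longrightarrow> R w" for n P R
  proof -
    obtain c where c: "c \<in> B" "T g \<le> c" "c \<le> T (b n)" "c (y n) = T (b n) (y n)"
        and c_off: "\<And>z. \<not> P z \<Longrightarrow> c z = T g z"
      using Y.bump[OF T_in[OF g] T_in[OF b(1)] T_le[OF g b] P] by blast
    have "\<not> c \<le> T g"
      using c(4) Tb[of n] by (auto simp: le_fun_def not_le intro!: exI[of _ "y n"])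
    then have "\<not> S c \<le> g"
      using inv.T_le_iff[of c "T g"] c g by simp
    then obtain w where w: "g w < S c w"
      by (auto simp: le_fun_def not_le)
    also have "S c w \<le> b n w"
      using inv.T_le_at[of c "T (b n)" w] c b by simp
    finally have "dist x w < inverse (Suc n)"
      using b_off[of n w] by force
    then show ?thesis
    proof (intro exI[of _ w] conjI R[OF c(1,2) _ w])
      show "P z" if "T g z < c z" for z
        using that c_off[of z] by force
    qed
  qed
  have closure: "x \<in> closure {w. R w}"
    if hit: "\<And>n. \<exists>w. dist x w < inverse (Suc (s (t n))) \<and> R w" and t: "\<And>n. n \<le> t n" for R and t :: "nat \<Rightarrow> nat"
    unfolding closure_approachable
  proof (intro allI impI)
    fix e :: real
    assume "e > 0"
    then obtain n where n: "inverse (real (Suc n)) < e"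
      using reals_Archimedean by blast
    have "n \<le> s (t n)"
      using t[of n] seq_suble[OF s, of "t n"] by simp
    then have "inverse (real (Suc (s (t n)))) \<le> inverse (real (Suc n))"
      by (simp add: field_simps)
    moreover obtain w where "dist x w < inverse (Suc (s (t n)))" "R w"
      using hit by blast
    ultimately show "\<exists>w\<in>{w. R w}. dist w x < e"
      using n by (intro bexI[of _ w]) (auto simp only: dist_commute mem_Collect_eq)
  qed
  have "x \<in> closure {w. F w \<le> S k w}"
  proof (rule closure[of "\<lambda>n. 2 * n"])
    show "\<exists>w. dist x w < inverse (real (Suc (s (2 * n)))) \<and> F w \<le> S k w" for n
    proof (rule near[OF even])
      show "F w \<le> S k w" if "c \<in> B" "T g \<le> c" "\<And>z. c z > T g z \<Longrightarrow> k z = T F z" "S c w > g w" for c w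
        using inv.le_on_carrier[of "T g" "T F" k c w] that g F k T_le[OF g F] by simp
    qed
  qed auto
  moreover have "closed {w. F w \<le> S k w}"
    using F k by (intro closed_Collect_le X.cont) auto
  moreover have "x \<in> closure {w. S k w \<le> g w}"
  proof (rule closure[of "\<lambda>n. 2 * n + 1"])
    show "\<exists>w. dist x w < inverse (real (Suc (s (2 * n + 1)))) \<and> S k w \<le> g w" for n
    proof (rule near[OF odd])
      show "S k w \<le> g w" if "c \<in> B" "T g \<le> c" "\<And>z. c z > T g z \<Longrightarrow> k z = T g z" "S c w > g w" for c w
        using inv.disjoint_carriers[of k "T g" c w] that g k by simp
    qed
  qed auto
  moreover have "closed {w. S k w \<le> g w}"
    using g k by (intro closed_Collect_le X.cont) auto
  ultimately have "F x \<le> S k x" "S k x \<le> g x"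
    by (simp_all add: closure_closed)
  then show False
    by (simp add: F_def)
qed

section \<open>The homeomorphism\<close>

definition paired where
  "paired x y \<longleftrightarrow> (\<forall>g\<in>A. linked A T g x y)"

text \<open>The partner of \<open>x\<close> does not depend on the base: a partner for \<open>inf g 0\<close> is one for both \<open>g\<close> and \<open>0\<close>
  by \<open>linked_mono\<close>, and the partner for \<open>0\<close> is unique.\<close>

lemma paired_exists: "\<exists>y. paired x y"
proof -
  have g0: "(\<lambda>_. 0) \<in> A"
    by (rule X.const)
  obtain y where y: "linked A T (\<lambda>_. 0) x y"
    using linked_exists[OF g0] by blast
  have "linked A T g x y" if g: "g \<in> A" for g
  proof -
    have inf: "inf g (\<lambda>_. 0) \<in> A"
      using g g0 by (rule X.inf)
    obtain y' where y': "linked A T (inf g (\<lambda>_. 0)) x y'"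
      using linked_exists[OF inf] by blast
    have "linked A T g x y'" "linked A T (\<lambda>_. 0) x y'"
      using linked_mono[OF y' inf] g g0 by simp_all
    then show ?thesis
      using linked_unique_right[OF y _ g0] by blast
  qed
  then show ?thesis
    unfolding paired_def by blast
qed

lemma paired_inverse: "lattice_iso.paired B S y x \<longleftrightarrow> paired x y"
proof -
  interpret inv: lattice_iso B A S
    by (rule inverse)
  show ?thesis
  proof
    assume p: "paired x y"
    show "inv.paired y x"
      unfolding inv.paired_def
    proof
      fix h
      assume "h \<in> B"
      then show "linked B S h y x"
        using linked_inverse[of "S h" x y] p by (simp add: paired_def)
    qed
  next
    assume p: "inv.paired y x"
    show "paired x y"
      unfolding paired_def
    proof
      fix g
      assume g: "g \<in> A"
      then have "linked A (inv_into B S) g x y"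
        using inv.linked_inverse[of "T g" y x] bspec[OF p[unfolded inv.paired_def], of "T g"] by simp
      then have "T f y = T g y" if "f \<in> A" "g \<le> f" "\<forall>\<^sub>F z in nhds x. f z = g z" for f
        using linkedD[OF _ that] inverse_of_S[OF that(1)] inverse_of_S[OF g] by metis
      then show "linked A T g x y"
        by (simp add: linked_def)
    qed
  qed
qed

lemma paired_le:
  assumes "paired x y" "f \<in> A" "g \<in> A" "\<forall>\<^sub>F z in nhds x. f z \<le> g z"
  shows "T f y \<le> T g y"
  using linked_le[of "inf f g" x y f g] assms X.inf[of f g] by (simp add: paired_def)

lemma paired_eq:
  assumes "paired x y" "f \<in> A" "g \<in> A" "\<forall>\<^sub>F z in nhds x. f z = g z"
  shows "T f y = T g y"
  using assms by (intro antisym paired_le[OF assms(1)]) (auto elim: eventually_mono)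

lemma paired_unique: "paired x y \<Longrightarrow> paired x y' \<Longrightarrow> y = y'"
  using linked_unique_right X.const[of 0] by (auto simp: paired_def)

definition point_map where "point_map x = (THE y. paired x y)"

lemma paired_point_map: "paired x (point_map x)"
  unfolding point_map_def using paired_exists paired_unique by (metis theI)

lemma paired_iff: "paired x y \<longleftrightarrow> y = point_map x"
  using paired_point_map paired_unique by blast

lemma point_map_inverse: "lattice_iso.point_map B S (point_map x) = x"
proof -
  interpret inv: lattice_iso B A S
    by (rule inverse)
  show ?thesis
    using paired_point_map paired_inverse inv.paired_iff by metis
qed

lemma point_map_inverse': "point_map (lattice_iso.point_map B S y) = y"
proof -
  interpret inv: lattice_iso B A S
    by (rule inverse)
  show ?thesis
    using inv.paired_point_map paired_inverse paired_iff by metis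
qed

lemma inv_point_map: "inv point_map = lattice_iso.point_map B S"
  by (rule inv_unique_comp) (auto simp: point_map_inverse point_map_inverse')

text \<open>Let \<open>k\<close> agree with \<open>T 1\<close> near \<open>point_map x\<close> and with \<open>T 0\<close> near every point off \<open>V\<close>. Then \<open>S k\<close> is
  \<open>1\<close> at \<open>x\<close> and \<open>0\<close> at every point mapped outside \<open>V\<close>, so \<open>{z. 0 < S k z}\<close> is a neighbourhood of \<open>x\<close>
  that is mapped into \<open>V\<close>.\<close>

lemma continuous_point_map: "continuous_on UNIV point_map"
proof -
  interpret inv: lattice_iso B A S
    by (rule inverse)
  have "open (point_map -` V)" if V: "open V" for V
  proof (subst open_subopen, intro ballI)
    fix x
    assume "x \<in> point_map -` V"
    then have "\<forall>\<^sub>F z in nhds (point_map x). z \<in> V"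
      using V by (intro eventually_nhds_in_open) auto
    define g F where "g = (\<lambda>_::'a. 0 :: real)" and "F = (\<lambda>_::'a. 1 :: real)"
    have g: "g \<in> A" and F: "F \<in> A" and gF: "g \<le> F"
      using X.const by (auto simp: g_def F_def le_fun_def)
    obtain k where k: "k \<in> B" "\<forall>\<^sub>F z in nhds (point_map x). k z = T F z"
        and k_off: "\<And>z. z \<notin> V \<Longrightarrow> \<forall>\<^sub>F w in nhds z. k w = T g w"
      using Y.bump[OF T_in[OF g] T_in[OF F] T_le[OF g F gF] \<open>\<forall>\<^sub>F z in nhds (point_map x). z \<in> V\<close>] by blast
    have "inv.paired (point_map z) z" for z
      using paired_inverse paired_point_map by blast
    then have at: "S k z = S (T f) z" if "f \<in> A" "\<forall>\<^sub>F w in nhds (point_map z). k w = T f w" for f z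
      using inv.paired_eq[of "point_map z" z k "T f"] k(1) that by simp
    have "x \<in> {z. g z < S k z}"
      using at[OF F k(2)] F by (simp add: g_def F_def)
    moreover have "open {z. g z < S k z}"
      using g k by (intro open_Collect_less X.cont) auto
    moreover have "{z. g z < S k z} \<subseteq> point_map -` V"
      using at[OF g k_off] g by force
    ultimately show "\<exists>U. open U \<and> x \<in> U \<and> U \<subseteq> point_map -` V"
      by blast
  qed
  then show ?thesis
    by (simp add: continuous_on_open_vimage)
qed

lemma homeomorphism_point_map: "homeomorphism UNIV UNIV point_map (inv point_map)"
proof -
  interpret inv: lattice_iso B A S
    by (rule inverse)
  show ?thesis
    unfolding inv_point_map homeomorphism_def
    using continuous_point_map inv.continuous_point_map point_map_inverse point_map_inverse' by (metis UNIV_I UNIV_eq_I rangeI)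
qed

section \<open>Dependence on a single value\<close>

text \<open>So far the value of \<open>T f\<close> at \<open>point_map x\<close> is known to depend only on the germ of \<open>f\<close> at \<open>x\<close>; in
  fact \<open>f x\<close> is enough. If \<open>f \<le> g\<close> agree at a non-isolated point \<open>x\<close>, some \<open>k\<close> between them equals
  \<open>g\<close> and \<open>f\<close> alternately near the points of a sequence tending to \<open>x\<close>, and it is continuous at \<open>x\<close>
  because it is squeezed. By continuity of \<open>T k\<close> and of \<open>point_map\<close>, the limit \<open>T k (point_map x)\<close> is
  both \<open>T g (point_map x)\<close> and \<open>T f (point_map x)\<close>.\<close>

lemma pointwise_eq:
  assumes A: "f \<in> A" "g \<in> A" "f \<le> g" and eq: "f x = g x"
  shows "T f (point_map x) = T g (point_map x)"
proof (cases "x islimpt UNIV")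
  case False
  then have "open {x}"
    by (simp add: islimpt_UNIV_iff)
  then have "\<forall>\<^sub>F z in nhds x. f z = g z"
    using eq by (auto simp: eventually_nhds)
  then show ?thesis
    using A by (intro paired_eq[OF paired_point_map])
next
  case True
  then obtain u where u: "\<And>n::nat. u n \<noteq> x" "u \<longlonglongrightarrow> x"
    unfolding islimpt_sequential by auto
  define v where "v z = inverse (dist z x)" for z
  have "filterlim (\<lambda>n. dist (u n) x) (at_right 0) sequentially"
    using u tendsto_dist[OF u(2) tendsto_const[of x]] by (auto simp: filterlim_at)
  then have "filterlim (\<lambda>n. v (u n)) at_top sequentially"
    unfolding v_def by (rule filterlim_compose[OF filterlim_inverse_at_top_right])
  then obtain s :: "nat \<Rightarrow> nat" and \<Psi> :: "real \<Rightarrow> real" where s: "strict_mono s"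
    and \<Psi>: "\<And>t. 0 \<le> \<Psi> t" "\<And>t u. \<bar>\<Psi> t - \<Psi> u\<bar> \<le> 4 * \<bar>t - u\<bar>" "\<And>t. t \<le> 1 \<Longrightarrow> \<Psi> t = 0"
    and even: "\<And>n. max 1 (v (u (s (2 * n)))) < \<Psi> (v (u (s (2 * n))))"
    and odd: "\<And>n t. \<bar>t - v (u (s (2 * n + 1)))\<bar> < 1 \<Longrightarrow> \<Psi> t = 0"
    by (rule oscillating_gauge[where c = "\<lambda>n. v (u n)"]) (rule that, assumption+)
  have "4-lipschitz_on UNIV \<Psi>"
    using \<Psi>(2) by (auto simp: lipschitz_on_def dist_real_def)
  then have \<Psi>_cont: "continuous_on UNIV \<Psi>"
    by (rule lipschitz_on_continuous_on)
  \<comment> \<open>At \<open>x\<close> the default value \<open>inverse 0 = 0\<close> makes \<open>v\<close>, and hence \<open>w\<close>, vanish.\<close>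
  define w where "w z = min 1 (\<Psi> (v z))" for z
  have w01: "0 \<le> w z" "w z \<le> 1" for z
    using \<Psi>(1) by (auto simp: w_def)
  have v_cont: "continuous_on (- {x}) v"
    unfolding v_def[abs_def] by (intro continuous_intros) auto
  have w_cont: "continuous_on (- {x}) w"
    unfolding w_def[abs_def] by (intro continuous_intros continuous_on_compose2[OF \<Psi>_cont v_cont]) auto
  define k where "k z = f z + w z * (g z - f z)" for z
  have f_le: "f z \<le> g z" for z
    using A by (simp add: le_fun_def)
  have fk: "f z \<le> k z" for z
    using w01 f_le by (simp add: k_def)
  have kg: "k z \<le> g z" for z
    using mult_right_mono[OF w01(2)[of z], of "g z - f z"] f_le[of z] by (simp add: k_def)
  have fg_cont: "isCont f z" "isCont g z" for z
    using X.cont A by (auto simp: continuous_on_eq_continuous_at)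
  have "isCont k z" for z
  proof (cases "z = x")
    case False
    then have "isCont w z"
      using w_cont by (auto simp: continuous_on_eq_continuous_at open_Compl)
    then show ?thesis
      unfolding k_def[abs_def] by (intro continuous_intros fg_cont)
  next
    case True
    have kx: "k x = f x" "k x = g x"
      using eq by (simp_all add: k_def)
    have "(k \<longlongrightarrow> k x) (at x)"
    proof (rule tendsto_sandwich)
      show "(f \<longlongrightarrow> k x) (at x)" "(g \<longlongrightarrow> k x) (at x)"
        using fg_cont[of x] kx by (simp_all add: isCont_def)
    qed (use fk kg in auto)
    then show ?thesis
      using True by (simp add: isCont_def)
  qed
  then have "continuous_on UNIV k"
    by (simp add: continuous_at_imp_continuous_on)
  moreover have "k z = f z" if "z \<notin> cball x 1" for z
  proof -
    have "v z \<le> 1"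
      using that by (simp add: v_def dist_commute inverse_le_1_iff)
    then show ?thesis
      by (simp add: k_def w_def \<Psi>(3))
  qed
  ultimately have k: "k \<in> A"
    using X.modify[OF A(1) _ X.proper] by blast
  have v_isCont: "isCont v (u n)" for n
    using v_cont u(1)[of n] by (auto simp: continuous_on_eq_continuous_at open_Compl)
  have "T k (point_map (u (s (2 * n)))) = T g (point_map (u (s (2 * n))))" for n
  proof (rule paired_eq[OF paired_point_map k A(2)])
    have "isCont (\<lambda>z. \<Psi> (v z)) (u (s (2 * n)))"
      using isCont_o2[OF v_isCont] \<Psi>_cont by (auto simp: continuous_on_eq_continuous_at)
    then have "((\<lambda>z. \<Psi> (v z)) \<longlongrightarrow> \<Psi> (v (u (s (2 * n))))) (nhds (u (s (2 * n))))"
      unfolding isCont_def by (subst (asm) tendsto_at_iff_tendsto_nhds)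
    then have "\<forall>\<^sub>F z in nhds (u (s (2 * n))). 1 < \<Psi> (v z)"
      using even[of n] by (intro order_tendstoD) auto
    then show "\<forall>\<^sub>F z in nhds (u (s (2 * n))). k z = g z"
      by eventually_elim (simp add: k_def w_def)
  qed
  moreover have "T k (point_map (u (s (2 * n + 1)))) = T f (point_map (u (s (2 * n + 1))))" for n
  proof (rule paired_eq[OF paired_point_map k A(1)])
    have "(v \<longlongrightarrow> v (u (s (2 * n + 1)))) (nhds (u (s (2 * n + 1))))"
      using v_isCont by (simp add: isCont_def tendsto_at_iff_tendsto_nhds)
    then have "\<forall>\<^sub>F z in nhds (u (s (2 * n + 1))). \<bar>v z - v (u (s (2 * n + 1)))\<bar> < 1"
      using tendstoD[of v _ _ 1] by (simp add: dist_real_def)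
    then show "\<forall>\<^sub>F z in nhds (u (s (2 * n + 1))). k z = f z"
      by eventually_elim (use odd in \<open>simp add: k_def w_def\<close>)
  qed
  moreover have lim: "(\<lambda>n. T h (point_map (u (s (r n))))) \<longlonglongrightarrow> T h (point_map x)" if "h \<in> A" "strict_mono r" for h and r :: "nat \<Rightarrow> nat"
  proof -
    have "strict_mono (s \<circ> r)"
      using s that(2) by (rule strict_mono_o)
    then have "(\<lambda>n. u (s (r n))) \<longlonglongrightarrow> x"
      using LIMSEQ_subseq_LIMSEQ[OF u(2)] by (fastforce simp: o_def)
    moreover have "isCont (\<lambda>z. T h (point_map z)) x"
      using continuous_on_compose2[OF Y.cont[OF T_in[OF that(1)]] continuous_point_map]
      by (auto simp: continuous_on_eq_continuous_at)
    ultimately show ?thesis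
      by (rule isCont_tendsto_compose[rotated])
  qed
  have "strict_mono (\<lambda>n::nat. 2 * n)" "strict_mono (\<lambda>n::nat. 2 * n + 1)"
    by (auto simp: strict_mono_def)
  note lims = lim[OF _ this(1)] lim[OF _ this(2)]
  ultimately have "T k (point_map x) = T g (point_map x)" "T k (point_map x) = T f (point_map x)"
    using LIMSEQ_unique[OF lims(1)[OF k]] LIMSEQ_unique[OF lims(2)[OF k]] lims(1)[OF A(2)] lims(2)[OF A(1)]
    by simp_all
  then show ?thesis
    by simp
qed

lemma pointwise_le:
  assumes "f \<in> A" "g \<in> A" "f x \<le> g x"
  shows "T f (point_map x) \<le> T g (point_map x)"
proof -
  have inf: "inf f g \<in> A"
    using assms by (simp add: X.inf)
  have "T f (point_map x) = T (inf f g) (point_map x)"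
    using assms by (intro pointwise_eq[symmetric] inf) (auto simp: inf_absorb1)
  also have "\<dots> \<le> T g (point_map x)"
    using assms inf by (intro T_le_at) auto
  finally show ?thesis .
qed

lemma pointwise_le_iff:
  assumes "f \<in> A" "g \<in> A"
  shows "T f (point_map x) \<le> T g (point_map x) \<longleftrightarrow> f x \<le> g x"
proof
  interpret inv: lattice_iso B A S
    by (rule inverse)
  assume "T f (point_map x) \<le> T g (point_map x)"
  then show "f x \<le> g x"
    using inv.pointwise_le[of "T f" "T g" "point_map x"] assms by (simp add: point_map_inverse)
qed (use assms pointwise_le in blast)

lemma induced_point_map: "induced_homeomorphism A T point_map"
  unfolding induced_homeomorphism_def
  using homeomorphism_point_map by (auto simp: pointwise_le_iff)

text \<open>If \<open>\<sigma> x\<close> and \<open>point_map x\<close> differed, some bump \<open>q\<close> over \<open>p\<close> at \<open>\<sigma> x\<close> would equal \<open>p\<close> near \<open>point_map x\<close>.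
  Then \<open>S q \<le> S p\<close> near \<open>x\<close> by the property of \<open>point_map\<close>, hence \<open>q \<le> p\<close> at \<open>\<sigma> x\<close> by that of \<open>\<sigma>\<close>.\<close>

lemma induced_unique:
  assumes \<sigma>: "induced_homeomorphism A T \<sigma>"
  shows "\<sigma> = point_map"
proof (rule ccontr)
  assume "\<sigma> \<noteq> point_map"
  then obtain x where "\<sigma> x \<noteq> point_map x"
    by blast
  then obtain V V' where V: "open V" "open V'" "\<sigma> x \<in> V" "point_map x \<in> V'" "V \<inter> V' = {}"
    using hausdorff by metis
  define p where "p = (\<lambda>_::'b. 0 :: real)"
  have p: "p \<in> B"
    using Y.const by (simp add: p_def)
  have "\<forall>\<^sub>F z in nhds (\<sigma> x). z \<in> V"
    using V by (intro eventually_nhds_in_open)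
  then obtain q where q: "q \<in> B" "q (\<sigma> x) = p (\<sigma> x) + 1" and q_off: "\<And>z. z \<notin> V \<Longrightarrow> q z = p z"
    using Y.unit_bump[OF p] by blast
  define U where "U = point_map -` V'"
  have "open U" "x \<in> U"
    using V continuous_point_map by (auto simp: U_def continuous_on_open_vimage)
  have "\<forall>y\<in>point_map ` U. T (S p) y \<ge> T (S q) y"
  proof (intro ballI)
    fix y
    assume "y \<in> point_map ` U"
    then have "y \<notin> V"
      using V(5) by (auto simp: U_def)
    then show "T (S p) y \<ge> T (S q) y"
      using p q(1) q_off by simp
  qed
  then have "\<forall>x\<in>U. S p x \<ge> S q x"
    using induced_point_map p q \<open>open U\<close> unfolding induced_homeomorphism_def by (meson S_in)
  then have "\<forall>y\<in>\<sigma> ` U. T (S p) y \<ge> T (S q) y"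
    using \<sigma> p q \<open>open U\<close> unfolding induced_homeomorphism_def by (meson S_in)
  then show False
    using p q \<open>x \<in> U\<close> by auto
qed

definition fibre_map where "fibre_map y r = T (\<lambda>_. r) y"

lemma T_eq_fibre_map:
  assumes "f \<in> A"
  shows "T f y = fibre_map y (f (inv point_map y))"
proof -
  have "T f (point_map x) = T (\<lambda>_. f x) (point_map x)" for x
    using assms X.const by (intro antisym) (simp_all add: pointwise_le_iff)
  then show ?thesis
    unfolding fibre_map_def inv_point_map by (metis point_map_inverse')
qed

lemma strict_mono_fibre_map: "strict_mono (fibre_map y)"
proof (rule strict_monoI)
  fix r s :: real
  assume "r < s"
  then have "\<not> T (\<lambda>_. s) (point_map (inv point_map y)) \<le> T (\<lambda>_. r) (point_map (inv point_map y))"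
    using X.const by (subst pointwise_le_iff) auto
  then show "fibre_map y r < fibre_map y s"
    by (simp add: fibre_map_def inv_point_map point_map_inverse')
qed

lemma surj_fibre_map: "surj (fibre_map y)"
proof (rule surjI)
  fix s
  show "fibre_map y (S (\<lambda>_. s) (inv point_map y)) = s"
    using Y.const[of s] by (simp add: T_eq_fibre_map[symmetric])
qed

end

section \<open>The representation theorem\<close>

lemma homeomorphism_strict_mono_surj:
  fixes f :: "real \<Rightarrow> real"
  assumes "strict_mono f" "surj f"
  shows "homeomorphism UNIV UNIV f (inv f)"
proof -
  have inj: "inj f"
    using assms(1) by (rule strict_mono_imp_inj_on)
  have "inv f x \<le> inv f y" if "x \<le> y" for x y
    using that assms by (metis strict_mono_less_eq surj_f_inv_f)
  moreover have "surj (inv f)"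
    using inj by (rule inj_imp_surj_inv)
  ultimately have "continuous_on UNIV (inv f)"
    by (intro continuous_onI_mono) auto
  moreover have "continuous_on UNIV f"
    using assms by (intro continuous_onI_mono) (auto simp: strict_mono_less_eq)
  ultimately show ?thesis
    using assms(2) inj \<open>surj (inv f)\<close> by (simp add: homeomorphism_def surj_f_inv_f)
qed

lemma (in lattice_iso) representation:
  "\<exists>\<tau>. induced_homeomorphism A T \<tau> \<and>
      (\<forall>\<sigma>. induced_homeomorphism A T \<sigma> \<longrightarrow> \<sigma> = \<tau>) \<and>
      (\<exists>\<tt> :: 'b \<Rightarrow> real \<Rightarrow> real.
         (\<forall>y. strict_mono (\<tt> y) \<and> homeomorphism UNIV UNIV (\<tt> y) (inv (\<tt> y))) \<and>
         (\<forall>f\<in>A. \<forall>y. T f y = \<tt> y (f (inv \<tau> y))))"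
proof (intro exI conjI allI impI ballI)
  show "induced_homeomorphism A T point_map"
    by (rule induced_point_map)
  show "\<sigma> = point_map" if "induced_homeomorphism A T \<sigma>" for \<sigma>
    using that by (rule induced_unique)
  show "strict_mono (fibre_map y)" "homeomorphism UNIV UNIV (fibre_map y) (inv (fibre_map y))" for y
    using strict_mono_fibre_map surj_fibre_map by (auto intro: homeomorphism_strict_mono_surj)
  show "T f y = fibre_map y (f (inv point_map y))" if "f \<in> A" for f y
    using that by (rule T_eq_fibre_map)
qed

theorem theorem3p6:
  assumes "proper_space TYPE('a::metric_space)" and "\<not> bounded (UNIV :: 'a set)"
    and "proper_space TYPE('b::metric_space)" and "\<not> bounded (UNIV :: 'b set)"
  shows "(\<forall>T :: ('a \<Rightarrow> real) \<Rightarrow> ('b \<Rightarrow> real). lattice_isomorphism SO SO T \<longrightarrow>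
            (\<exists>\<tau>. induced_homeomorphism SO T \<tau> \<and>
                 (\<forall>\<sigma>. induced_homeomorphism SO T \<sigma> \<longrightarrow> \<sigma> = \<tau>) \<and>
                 (\<exists>\<tt> :: 'b \<Rightarrow> real \<Rightarrow> real.
                    (\<forall>y. strict_mono (\<tt> y) \<and> homeomorphism UNIV UNIV (\<tt> y) (inv (\<tt> y))) \<and>
                    (\<forall>f\<in>SO. \<forall>y. T f y = \<tt> y (f (inv \<tau> y))))))
       \<and> (\<forall>T :: ('a \<Rightarrow> real) \<Rightarrow> ('b \<Rightarrow> real). lattice_isomorphism SO_bdd SO_bdd T \<longrightarrow>
            (\<exists>\<tau>. induced_homeomorphism SO_bdd T \<tau> \<and>
                 (\<forall>\<sigma>. induced_homeomorphism SO_bdd T \<sigma> \<longrightarrow> \<sigma> = \<tau>) \<and>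
                 (\<exists>\<tt> :: 'b \<Rightarrow> real \<Rightarrow> real.
                    (\<forall>y. strict_mono (\<tt> y) \<and> homeomorphism UNIV UNIV (\<tt> y) (inv (\<tt> y))) \<and>
                    (\<forall>f\<in>SO_bdd. \<forall>y. T f y = \<tt> y (f (inv \<tau> y))))))"
proof (intro conjI allI impI)
  show "\<exists>\<tau>. induced_homeomorphism SO T \<tau> \<and>
                 (\<forall>\<sigma>. induced_homeomorphism SO T \<sigma> \<longrightarrow> \<sigma> = \<tau>) \<and>
                 (\<exists>\<tt> :: 'b \<Rightarrow> real \<Rightarrow> real.
                    (\<forall>y. strict_mono (\<tt> y) \<and> homeomorphism UNIV UNIV (\<tt> y) (inv (\<tt> y))) \<and>
                    (\<forall>f\<in>SO. \<forall>y. T f y = \<tt> y (f (inv \<tau> y))))"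
    if "lattice_isomorphism SO SO T" for T :: "('a \<Rightarrow> real) \<Rightarrow> ('b \<Rightarrow> real)"
    by (rule lattice_iso.representation[OF lattice_iso.intro[OF separating_lattice_SO[OF assms(1)]
            separating_lattice_SO[OF assms(3)] lattice_iso_axioms.intro[OF that]]])
  show "\<exists>\<tau>. induced_homeomorphism SO_bdd T \<tau> \<and>
                 (\<forall>\<sigma>. induced_homeomorphism SO_bdd T \<sigma> \<longrightarrow> \<sigma> = \<tau>) \<and>
                 (\<exists>\<tt> :: 'b \<Rightarrow> real \<Rightarrow> real.
                    (\<forall>y. strict_mono (\<tt> y) \<and> homeomorphism UNIV UNIV (\<tt> y) (inv (\<tt> y))) \<and>
                    (\<forall>f\<in>SO_bdd. \<forall>y. T f y = \<tt> y (f (inv \<tau> y))))"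
    if "lattice_isomorphism SO_bdd SO_bdd T" for T :: "('a \<Rightarrow> real) \<Rightarrow> ('b \<Rightarrow> real)"
    by (rule lattice_iso.representation[OF lattice_iso.intro[OF separating_lattice_SO_bdd[OF assms(1)]
            separating_lattice_SO_bdd[OF assms(3)] lattice_iso_axioms.intro[OF that]]])
qed

end
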